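(* Let $G=P_n\square P_m$ be the Cartesian product of the paths on $n\ge3$ and $m\ge3$ vertices, with its standard plane (grid) embedding. Then $\pi_{fl}(G)\le5$.
   Context: A sequence $r_1\dots r_{2n}$ is a repetition if $r_i=r_{n+i}$ for all $i\le n$. In a plane graph $G$, a facial path is a path whose vertices and edges are consecutive on the boundary walk of some face of $G$. A vertex colouring is facial non-repetitive if no facial path on vertices $v_1,\dots,v_{2n}$ ($n\ge1$) has colour sequence that is a repetition. $\pi_{fl}(G)$ is the minimum $l$ such that for every assignment of lists $L(v)\subseteq\mathbb{Z}_+$ with $|L(v)|\ge l$ there is a facial non-repetitive colouring $\varphi$ with $\varphi(v)\in L(v)$ for every vertex $v$. *)

theory Defs
  imports
    "HOL-Analysis.Analysis"
    "HOL-Library.Extended_Nat"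
    "Graph_Theory.Pair_Digraph"
    "Graph_Theory.Vertex_Walk"
begin

text \<open>
  An undirected simple graph is a symmetric loop-free pair digraph: an edge \<open>uv\<close> is the pair of
  arcs \<open>(u, v)\<close> and \<open>(v, u)\<close>, i.e.\ the two sides of the edge in a drawing.
\<close>

definition path_graph :: "nat \<Rightarrow> nat pair_pre_digraph" where
  "path_graph n = \<lparr>pverts = {1..n},
     parcs = {(i, j). i \<in> {1..n} \<and> j \<in> {1..n} \<and> (j = Suc i \<or> i = Suc j)}\<rparr>"

definition cartesian_product ::
  "'a pair_pre_digraph \<Rightarrow> 'b pair_pre_digraph \<Rightarrow> ('a \<times> 'b) pair_pre_digraph" where
  "cartesian_product G H = \<lparr>pverts = pverts G \<times> pverts H,
     parcs = {((a, b), (a', b')).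
       (a = a' \<and> a \<in> pverts G \<and> (b, b') \<in> parcs H) \<or>
       (b = b' \<and> b \<in> pverts H \<and> (a, a') \<in> parcs G)}\<rparr>"


section \<open>Plane graphs with straight edges, and their facial paths\<close>

text \<open>
  A straight-line drawing of \<open>G\<close> is given by the positions \<open>pos\<close> of its vertices in the complex
  plane.
\<close>

definition plane_graph :: "'a pair_pre_digraph \<Rightarrow> ('a \<Rightarrow> complex) \<Rightarrow> bool" where
  "plane_graph G pos \<longleftrightarrow> pair_graph G \<and> inj_on pos (pverts G) \<and>
     (\<forall>w\<in>pverts G. \<forall>(u, v)\<in>parcs G. pos w \<notin> open_segment (pos u) (pos v)) \<and>
     (\<forall>(u, v)\<in>parcs G. \<forall>(x, y)\<in>parcs G. {u, v} \<noteq> {x, y} \<longrightarrow>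
        open_segment (pos u) (pos v) \<inter> open_segment (pos x) (pos y) = {})"

definition drawing :: "'a pair_pre_digraph \<Rightarrow> ('a \<Rightarrow> complex) \<Rightarrow> complex set" where
  "drawing G pos = pos ` pverts G \<union> (\<Union>(u, v)\<in>parcs G. closed_segment (pos u) (pos v))"

definition faces :: "'a pair_pre_digraph \<Rightarrow> ('a \<Rightarrow> complex) \<Rightarrow> complex set set" where
  "faces G pos = components (- drawing G pos)"

text \<open>The set \<open>F\<close> lies immediately to the left of the edge \<open>uv\<close> when it is traversed from
  \<open>u\<close> to \<open>v\<close>.\<close>

definition left_of_arc :: "('a \<Rightarrow> complex) \<Rightarrow> complex set \<Rightarrow> 'a \<Rightarrow> 'a \<Rightarrow> bool" where
  "left_of_arc pos F u v \<longleftrightarrow> (\<forall>z \<in> open_segment (pos u) (pos v).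
     \<forall>\<^sub>F t in at_right 0. z + of_real t * \<i> * (pos v - pos u) \<in> F)"

text \<open>
  The angle in \<open>(0, 2\<pi>]\<close> of the clockwise rotation about \<open>v\<close> that takes the direction of the edge
  \<open>vu\<close> to the direction of the edge \<open>vw\<close>. It is a full turn for \<open>w = u\<close>, so that a walk arriving
  at a vertex of degree one turns back.
\<close>

definition clockwise_angle :: "('a \<Rightarrow> complex) \<Rightarrow> 'a \<Rightarrow> 'a \<Rightarrow> 'a \<Rightarrow> real" where
  "clockwise_angle pos u v w =
     (if w = u then 2 * pi else Arg2pi ((pos u - pos v) / (pos w - pos v)))"

text \<open>A walk that arrives at \<open>v\<close> from \<open>u\<close>, following the boundary of the face on its left,
  leaves \<open>v\<close> along the first edge clockwise from \<open>vu\<close>.\<close>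

definition boundary_successor ::
  "'a pair_pre_digraph \<Rightarrow> ('a \<Rightarrow> complex) \<Rightarrow> 'a \<Rightarrow> 'a \<Rightarrow> 'a \<Rightarrow> bool" where
  "boundary_successor G pos u v w \<longleftrightarrow> (v, w) \<in> parcs G \<and>
     (\<forall>x. (v, x) \<in> parcs G \<longrightarrow> clockwise_angle pos u v w \<le> clockwise_angle pos u v x)"

text \<open>
  A boundary walk of the face \<open>F\<close> is a closed walk, given by the cyclic sequence \<open>c\<close> of its
  vertices, that runs along \<open>F\<close> with \<open>F\<close> on its left and passes each side of an edge at most once.
\<close>

definition boundary_walk ::
  "'a pair_pre_digraph \<Rightarrow> ('a \<Rightarrow> complex) \<Rightarrow> complex set \<Rightarrow> 'a list \<Rightarrow> bool" where
  "boundary_walk G pos F c \<longleftrightarrow> c \<noteq> [] \<and> distinct (zip c (rotate1 c)) \<and>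
     (\<forall>i < length c.
        let u = c ! i;
            v = c ! (Suc i mod length c);
            w = c ! (Suc (Suc i) mod length c)
        in (u, v) \<in> parcs G \<and> left_of_arc pos F u v \<and> boundary_successor G pos u v w)"

definition consecutive_on_cycle :: "'a list \<Rightarrow> 'a list \<Rightarrow> bool" where
  "consecutive_on_cycle p c \<longleftrightarrow>
     (\<exists>s. \<forall>i < length p. p ! i = c ! ((s + i) mod length c))"

text \<open>A boundary walk has its face on the left, whereas a facial path may run in either direction.\<close>

definition facial_path :: "'a pair_pre_digraph \<Rightarrow> ('a \<Rightarrow> complex) \<Rightarrow> 'a list \<Rightarrow> bool" where
  "facial_path G pos p \<longleftrightarrow> vpath p (with_proj G) \<and>
     (\<exists>F \<in> faces G pos. \<exists>c. boundary_walk G pos F c \<and>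
        (consecutive_on_cycle p c \<or> consecutive_on_cycle (rev p) c))"


section \<open>Facial non-repetitive colourings\<close>

definition repetition :: "'b list \<Rightarrow> bool" where
  "repetition r \<longleftrightarrow> (\<exists>n \<ge> 1. length r = 2 * n \<and> (\<forall>i < n. r ! i = r ! (n + i)))"

definition facial_nonrepetitive ::
  "'a pair_pre_digraph \<Rightarrow> ('a \<Rightarrow> complex) \<Rightarrow> ('a \<Rightarrow> 'b) \<Rightarrow> bool" where
  "facial_nonrepetitive G pos \<phi> \<longleftrightarrow> (\<forall>p. facial_path G pos p \<longrightarrow> \<not> repetition (map \<phi> p))"

text \<open>Lists may be infinite; \<open>card\<close> is \<open>0\<close> on infinite sets, hence the disjunction.\<close>

definition facial_nonrepetitive_choosable ::
  "'a pair_pre_digraph \<Rightarrow> ('a \<Rightarrow> complex) \<Rightarrow> nat \<Rightarrow> bool" where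
  "facial_nonrepetitive_choosable G pos l \<longleftrightarrow>
     (\<forall>L :: 'a \<Rightarrow> nat set.
        (\<forall>v \<in> pverts G. L v \<subseteq> {1..} \<and> (infinite (L v) \<or> l \<le> card (L v))) \<longrightarrow>
        (\<exists>\<phi>. (\<forall>v \<in> pverts G. \<phi> v \<in> L v) \<and> facial_nonrepetitive G pos \<phi>))"

text \<open>The minimum of the empty set is \<open>\<infinity>\<close>.\<close>

definition pi_fl :: "'a pair_pre_digraph \<Rightarrow> ('a \<Rightarrow> complex) \<Rightarrow> enat" where
  "pi_fl G pos = Inf {enat l |l. facial_nonrepetitive_choosable G pos l}"


section \<open>The standard plane embedding of the grid\<close>

definition grid_pos :: "nat \<times> nat \<Rightarrow> complex" where
  "grid_pos v = Complex (real (fst v)) (real (snd v))"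

lemma pair_graph_grid: "pair_graph (cartesian_product (path_graph n) (path_graph m))"
proof
  let ?G = "cartesian_product (path_graph n) (path_graph m)"
  have sub: "parcs ?G \<subseteq> pverts ?G \<times> pverts ?G"
    by (auto simp: cartesian_product_def path_graph_def)
  show fin: "finite (pverts ?G)"
    by (simp add: cartesian_product_def path_graph_def)
  show "finite (parcs ?G)"
    using finite_subset[OF sub] fin by simp
  show "fst e \<in> pverts ?G" "snd e \<in> pverts ?G" if "e \<in> parcs ?G" for e
    using sub that by auto
  show "fst e \<noteq> snd e" if "e \<in> parcs ?G" for e
    using that by (auto simp: cartesian_product_def path_graph_def)
  show "symmetric (with_proj ?G)"
    by (auto simp: symmetric_def sym_def cartesian_product_def path_graph_def)
qed

lemma open_segment_grid:
  assumes "((a, b), (c, d)) \<in> parcs (cartesian_product (path_graph n) (path_graph m))"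
    and "z \<in> open_segment (grid_pos (a, b)) (grid_pos (c, d))"
  shows "(b = d \<and> (c = Suc a \<or> a = Suc c) \<and> Im z = real b \<and>
            real (min a c) < Re z \<and> Re z < real (min a c) + 1) \<or>
         (a = c \<and> (d = Suc b \<or> b = Suc d) \<and> Re z = real a \<and>
            real (min b d) < Im z \<and> Im z < real (min b d) + 1)"
proof -
  obtain t where t: "0 < t" "t < 1"
    and z: "z = (1 - t) *\<^sub>R grid_pos (a, b) + t *\<^sub>R grid_pos (c, d)"
    using assms(2) by (auto simp: in_segment)
  show ?thesis
    using assms(1) t
    by (auto simp: z grid_pos_def cartesian_product_def path_graph_def algebra_simps)
qed

lemma plane_graph_grid:
  "plane_graph (cartesian_product (path_graph n) (path_graph m)) grid_pos"
  unfolding plane_graph_def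
proof (intro conjI ballI, goal_cases)
  case 1
  show ?case by (rule pair_graph_grid)
next
  case 2
  show ?case by (auto simp: inj_on_def grid_pos_def)
next
  case (3 w e)
  obtain a b c d where e: "e = ((a, b), (c, d))" by (metis surj_pair)
  have "grid_pos w \<notin> open_segment (grid_pos (a, b)) (grid_pos (c, d))"
  proof
    assume "grid_pos w \<in> open_segment (grid_pos (a, b)) (grid_pos (c, d))"
    from open_segment_grid[OF 3(2)[unfolded e] this] show False
      by (auto simp: grid_pos_def)
  qed
  then show ?case by (simp add: e)
next
  case (4 e)
  obtain a b c d where e: "e = ((a, b), (c, d))" by (metis surj_pair)
  have "{(a, b), (c, d)} = {(a', b'), (c', d')}"
    if f: "((a', b'), (c', d')) \<in> parcs (cartesian_product (path_graph n) (path_graph m))"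
      and z: "z \<in> open_segment (grid_pos (a, b)) (grid_pos (c, d))"
        "z \<in> open_segment (grid_pos (a', b')) (grid_pos (c', d'))" for a' b' c' d' z
  proof -
    have *: "i = j" if "real i < x" "x < real i + 1" "real j < x" "x < real j + 1" for i j x
      using that by linarith
    show ?thesis
      using open_segment_grid[OF 4[unfolded e] z(1)] open_segment_grid[OF f z(2)]
      by (elim disjE conjE) (auto dest: * simp: doubleton_eq_iff)
  qed
  then show ?case unfolding e by fast
qed

end

theory Submission
  imports Defs
begin

text \<open>
  The facial paths of the grid run around a unit square or along the outer cycle. Paths are
  non-repetitively 4-choosable: the words from given lists that contain no square at least double
  in number with each letter, since an extension of such a word that does contain a square is
  determined by a proper prefix. On the outer cycle, lists of size five allow to give one vertex a
  colour that is deleted from all other lists; no repetition passes through that vertex, and the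
  rest is a path with lists of size four. An interior vertex then has to avoid the colours of its
  neighbours and, for each of its squares in which its two neighbours agree, the colour of the
  opposite corner. These are at most four colours unless all four neighbours are already coloured
  and agree. In a suitable order this can only happen at the last interior vertex, a corner of the
  interior, and there two of the neighbours are outer vertices, one of them with the special colour.
\<close>

section \<open>Non-repetitive list colourings of paths and cycles\<close>

definition square_free :: "'a list \<Rightarrow> bool" where
  "square_free w \<longleftrightarrow>
     (\<forall>t k. 1 \<le> k \<and> t + 2 * k \<le> length w \<longrightarrow> (\<exists>i<k. w ! (t + i) \<noteq> w ! (t + k + i)))"

definition square_free_words :: "(nat \<Rightarrow> 'a set) \<Rightarrow> nat \<Rightarrow> 'a list set" where
  "square_free_words L n = {w. length w = n \<and> (\<forall>i<n. w ! i \<in> L i) \<and> square_free w}"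

lemma square_free_take: "square_free w \<Longrightarrow> square_free (take j w)"
  unfolding square_free_def
proof (intro allI impI)
  fix t k :: nat
  assume sf: "\<forall>t k. 1 \<le> k \<and> t + 2 * k \<le> length w \<longrightarrow> (\<exists>i<k. w ! (t + i) \<noteq> w ! (t + k + i))"
    and k: "1 \<le> k \<and> t + 2 * k \<le> length (take j w)"
  then obtain i where "i < k" "w ! (t + i) \<noteq> w ! (t + k + i)" by auto
  then show "\<exists>i<k. take j w ! (t + i) \<noteq> take j w ! (t + k + i)"
    using k by (intro exI[of _ i]) auto
qed

lemma square_free_words_take:
  "w \<in> square_free_words L n \<Longrightarrow> j \<le> n \<Longrightarrow> take j w \<in> square_free_words L j"
  by (auto simp: square_free_words_def square_free_take)

lemma finite_square_free_words:
  assumes "\<And>i. finite (L i)"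
  shows "finite (square_free_words L n)"
proof (rule finite_subset)
  show "square_free_words L n \<subseteq> {w. set w \<subseteq> (\<Union>i<n. L i) \<and> length w = n}"
    by (fastforce simp: square_free_words_def in_set_conv_nth)
  show "finite {w. set w \<subseteq> (\<Union>i<n. L i) \<and> length w = n}"
    using assms by (intro finite_lists_length_eq) auto
qed

text \<open>
  If a one-letter extension of a square-free word contains a square, the square is a suffix, and
  its second half is determined by the prefix before it.
\<close>

lemma extension_cases:
  assumes w: "w \<in> square_free_words L n" and x: "x \<in> L n"
  shows "w @ [x] \<in> square_free_words L (Suc n) \<union>
    (\<Union>j\<le>n. (\<lambda>u. u @ drop (2 * j - Suc n) u) ` square_free_words L j)"
proof (cases "square_free (w @ [x])")
  case True
  then show ?thesis
    using w x by (auto simp: square_free_words_def nth_append less_Suc_eq)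
next
  case False
  have len: "length w = n" using w by (simp add: square_free_words_def)
  obtain t k where k: "1 \<le> k" "t + 2 * k \<le> Suc n"
    and sq: "\<And>i. i < k \<Longrightarrow> (w @ [x]) ! (t + i) = (w @ [x]) ! (t + k + i)"
    using False len unfolding square_free_def by auto
  have end_: "t + 2 * k = Suc n"
  proof (rule ccontr)
    assume "t + 2 * k \<noteq> Suc n"
    then have le: "t + 2 * k \<le> n" using k by simp
    then have "w ! (t + i) = w ! (t + k + i)" if "i < k" for i
      using sq[OF that] that len by (simp add: nth_append)
    then show False
      using w k(1) le len unfolding square_free_words_def square_free_def by blast
  qed
  \<comment> \<open>The second half of the square starts at \<open>t + k\<close> and copies what
    starts at \<open>t\<close>. As the square ends at \<open>Suc n\<close>, \<open>t\<close> equals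
    \<open>2 * (t + k) - Suc n\<close>, so the length of the prefix alone determines the whole
    word.\<close>
  let ?j = "t + k" and ?u = "take (t + k) w"
  have j: "?j \<le> n" using end_ k by simp
  have "w @ [x] = ?u @ drop (2 * ?j - Suc n) ?u"
  proof (rule nth_equalityI)
    show "length (w @ [x]) = length (?u @ drop (2 * ?j - Suc n) ?u)"
      using len end_ j by simp
    fix i assume i: "i < length (w @ [x])"
    show "(w @ [x]) ! i = (?u @ drop (2 * ?j - Suc n) ?u) ! i"
    proof (cases "i < ?j")
      case True
      then show ?thesis using j len by (simp add: nth_append)
    next
      case False
      define r where "r = i - ?j"
      have r: "i = t + k + r" "r < k" using False i len end_ by (auto simp: r_def)
      have "2 * ?j - Suc n = t" using end_ by simp
      then show ?thesis
        using sq[OF r(2)] r j len by (simp add: nth_append)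
    qed
  qed
  moreover have "?u \<in> square_free_words L ?j"
    using square_free_words_take[OF w j] .
  ultimately show ?thesis using j by blast
qed

text \<open>Counts the one-letter extensions of words of length \<open>n\<close>: each one that
  fails to be square-free is the image of a square-free word of some length \<open>j \<le> n\<close>
  under a map that depends only on \<open>j\<close> and \<open>n\<close>.\<close>

lemma card_square_free_words_extend:
  assumes L: "\<And>i. finite (L i)" "\<And>i. card (L i) = l"
  shows "l * card (square_free_words L n) \<le>
    card (square_free_words L (Suc n)) + (\<Sum>j\<le>n. card (square_free_words L j))"
proof -
  note fin = finite_square_free_words[of L, OF L(1)]
  let ?E = "(\<lambda>(w, x). w @ [x]) ` (square_free_words L n \<times> L n)"
  let ?B = "\<lambda>j. (\<lambda>u. u @ drop (2 * j - Suc n) u) ` square_free_words L j"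
  have "l * card (square_free_words L n) = card ?E"
    by (subst card_image) (auto simp: inj_on_def card_cartesian_product L)
  also have "\<dots> \<le> card (square_free_words L (Suc n) \<union> (\<Union>j\<le>n. ?B j))"
  proof (rule card_mono)
    show "?E \<subseteq> square_free_words L (Suc n) \<union> (\<Union>j\<le>n. ?B j)"
    proof
      fix y assume "y \<in> ?E"
      then obtain w x where "w \<in> square_free_words L n" "x \<in> L n" "y = w @ [x]" by auto
      then show "y \<in> square_free_words L (Suc n) \<union> (\<Union>j\<le>n. ?B j)"
        using extension_cases[of w L n x] by (simp only:)
    qed
  qed (simp add: fin)
  also have "\<dots> \<le> card (square_free_words L (Suc n)) + card (\<Union>j\<le>n. ?B j)"
    by (rule card_Un_le)
  also have "card (\<Union>j\<le>n. ?B j) \<le> (\<Sum>j\<le>n. card (?B j))"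
    by (rule card_UN_le) simp
  also have "\<dots> \<le> (\<Sum>j\<le>n. card (square_free_words L j))"
    by (intro sum_mono card_image_le fin)
  finally show ?thesis by simp
qed

lemma square_free_words_nonempty:
  assumes "\<And>i. finite (L i)" "\<And>i. card (L i) = 4"
  shows "square_free_words L n \<noteq> {}"
proof -
  let ?c = "\<lambda>j. card (square_free_words L j)"
  \<comment> \<open>The partial sums stay below twice the last term, as in a geometric progression
    of ratio 2. Of the \<open>4 * ?c n\<close> extensions at most \<open>2 * ?c n\<close> are lost,
    so the count doubles, and this restores the bound for \<open>Suc n\<close>.\<close>
  have "?c n > 0 \<and> (\<Sum>j\<le>n. ?c j) \<le> 2 * ?c n"
  proof (induction n)
    case 0
    have "square_free_words L 0 = {[]}"
      by (auto simp: square_free_words_def square_free_def)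
    then show ?case by simp
  next
    case (Suc n)
    then show ?case using card_square_free_words_extend[of L 4 n] assms by simp
  qed
  then show ?thesis by auto
qed

lemma path_nonrepetitive_4_choosable:
  fixes L :: "nat \<Rightarrow> 'a set"
  assumes "\<And>i. i < n \<Longrightarrow> finite (L i) \<and> 4 \<le> card (L i)"
  obtains c where "\<And>i. i < n \<Longrightarrow> c i \<in> L i"
    and "\<And>t k. 1 \<le> k \<Longrightarrow> t + 2 * k \<le> n \<Longrightarrow> \<exists>i<k. c (t + i) \<noteq> c (t + k + i)"
proof (cases "n = 0")
  case True
  then show ?thesis using that by simp
next
  case False
  \<comment> \<open>The counting needs a list of exactly four letters at every index, so the lists
    are trimmed, and \<open>min\<close> repeats the last one beyond the end of the path.\<close>
  have "\<exists>A. A \<subseteq> L (min i (n - 1)) \<and> finite A \<and> card A = 4" for i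
    using assms[of "min i (n - 1)"] False obtain_subset_with_card_n[of 4 "L (min i (n - 1))"]
    by (metis diff_less finite_subset less_one min.strict_coboundedI2 neq0_conv)
  then obtain M where M: "\<And>i. M i \<subseteq> L (min i (n - 1)) \<and> finite (M i) \<and> card (M i) = 4"
    by metis
  obtain w where w: "w \<in> square_free_words M n"
    using square_free_words_nonempty[of M n] M by blast
  show ?thesis
  proof (rule that[of "(!) w"])
    fix i assume "i < n"
    then have "w ! i \<in> M i" "min i (n - 1) = i" using w by (auto simp: square_free_words_def)
    then show "w ! i \<in> L i" using M by force
  next
    fix t k :: nat assume "1 \<le> k" "t + 2 * k \<le> n"
    then show "\<exists>i<k. w ! (t + i) \<noteq> w ! (t + k + i)"
      using w unfolding square_free_words_def square_free_def by blast
  qed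
qed

text \<open>
  The first vertex gets a colour that is removed from all other lists, so that no repetition
  can pass through it.
\<close>

lemma cycle_nonrepetitive_5_choosable:
  fixes L :: "nat \<Rightarrow> 'a set"
  assumes N: "N > 0" and L: "\<And>i. i < N \<Longrightarrow> finite (L i) \<and> 5 \<le> card (L i)"
  obtains c where "\<And>i. i < N \<Longrightarrow> c i \<in> L i"
    and "\<And>i. 0 < i \<Longrightarrow> i < N \<Longrightarrow> c i \<noteq> c 0"
    and "\<And>t k. 1 \<le> k \<Longrightarrow> 2 * k \<le> N \<Longrightarrow>
      \<exists>i<k. c ((t + i) mod N) \<noteq> c ((t + k + i) mod N)"
proof -
  obtain a where a: "a \<in> L 0" using L[OF N] by fastforce
  have "finite (L (Suc i) - {a}) \<and> 4 \<le> card (L (Suc i) - {a})" if "i < N - 1" for i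
    using L[of "Suc i"] that diff_card_le_card_Diff[of "{a}" "L (Suc i)"]
    by (auto simp: less_diff_conv)
  then obtain d where d: "\<And>i. i < N - 1 \<Longrightarrow> d i \<in> L (Suc i) - {a}"
    and nonrep: "\<And>t k. 1 \<le> k \<Longrightarrow> t + 2 * k \<le> N - 1 \<Longrightarrow> \<exists>i<k. d (t + i) \<noteq> d (t + k + i)"
    using path_nonrepetitive_4_choosable[of "N - 1" "\<lambda>i. L (Suc i) - {a}"] by blast
  define c where "c = (\<lambda>i. if i = 0 then a else d (i - 1))"
  have c: "c i \<in> L i - {a}" if "0 < i" "i < N" for i
    using d[of "i - 1"] that by (simp add: c_def)
  have c0: "c i = a \<longleftrightarrow> i = 0" if "i < N" for i
    using c[of i] that by (auto simp: c_def)
  show ?thesis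
  proof (rule that[of c])
    show "c i \<in> L i" if "i < N" for i
      using c[of i] that a by (cases "i = 0") (auto simp: c_def)
    show "c i \<noteq> c 0" if "0 < i" "i < N" for i
      using c0 that N by auto
    fix t k :: nat assume k: "1 \<le> k" "2 * k \<le> N"
    \<comment> \<open>Positions at distance \<open>k\<close> are distinct modulo \<open>N\<close>,
      since \<open>0 < k < N\<close>.\<close>
    have part: "(j + k) mod N \<noteq> 0" if "j mod N = 0" for j
      using that k by (metis add_0 add.commute mod_add_right_eq mod_less not_one_le_zero
          less_le_trans mult_2 less_add_same_cancel1 gr0I)
    show "\<exists>i<k. c ((t + i) mod N) \<noteq> c ((t + k + i) mod N)"
    proof (rule ccontr)
      assume "\<not> ?thesis"
      then have eq: "c ((t + i) mod N) = c ((t + k + i) mod N)" if "i < k" for i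
        using that by blast
      \<comment> \<open>The colour \<open>a\<close> occurs only at vertex 0, so of two positions
        with equal colours either both or neither are vertex 0, and both is impossible by
        \<open>part\<close>.\<close>
      have both: "(t + i) mod N \<noteq> 0 \<and> (t + k + i) mod N \<noteq> 0" if "i < k" for i
      proof -
        have "(t + i) mod N = 0 \<longleftrightarrow> (t + k + i) mod N = 0"
          using eq[OF that] c0[of "(t + i) mod N"] c0[of "(t + k + i) mod N"] N by simp
        moreover have "t + k + i = (t + i) + k" by simp
        ultimately show ?thesis using part by metis
      qed
      have nz: "(t + i) mod N \<noteq> 0" if "i < 2 * k" for i
      proof (cases "i < k")
        case False
        then have "(t + k + (i - k)) mod N \<noteq> 0" using both[of "i - k"] that by auto
        then show ?thesis using False by simp
      qed (use both in blast)
      define s where "s = t mod N"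
      have s: "0 < s" "s < N" using nz[of 0] k N by (auto simp: s_def)
      \<comment> \<open>A window that wrapped around would meet vertex 0 at offset
        \<open>N - s\<close>. Hence it is a segment of the path \<open>1, ..., N - 1\<close>, on
        which \<open>c\<close> is \<open>d\<close> shifted by one.\<close>
      have fit: "s + 2 * k \<le> N"
      proof (rule ccontr)
        assume "\<not> ?thesis"
        then have "N - s < 2 * k" using s by simp
        moreover have "(t + (N - s)) mod N = (s + (N - s)) mod N"
          by (simp add: s_def mod_add_left_eq)
        ultimately show False using nz[of "N - s"] s by simp
      qed
      have red: "(t + i) mod N = s + i" if "i < 2 * k" for i
      proof -
        have "(t + i) mod N = (s + i) mod N" by (simp add: s_def mod_add_left_eq)
        then show ?thesis using that fit by simp
      qed
      have "s - 1 + 2 * k \<le> N - 1" using s fit by simp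
      then obtain i where i: "i < k" "d (s - 1 + i) \<noteq> d (s - 1 + k + i)"
        using nonrep[OF k(1)] by blast
      have "c (s + i) = c (s + k + i)"
        using eq[OF i(1)] red[of i] red[of "k + i"] i(1) by (simp flip: add.assoc)
      then show False using i s by (simp add: c_def)
    qed
  qed
qed

section \<open>Boundary walks of the grid\<close>

abbreviation grid :: "nat \<Rightarrow> nat \<Rightarrow> (nat \<times> nat) pair_pre_digraph" where
  "grid n m \<equiv> cartesian_product (path_graph n) (path_graph m)"

lemma pverts_grid: "pverts (grid n m) = {1..n} \<times> {1..m}"
  by (simp add: cartesian_product_def path_graph_def)

lemma parcs_grid:
  "((a, b), (c, d)) \<in> parcs (grid n m) \<longleftrightarrow>
     a \<in> {1..n} \<and> b \<in> {1..m} \<and> c \<in> {1..n} \<and> d \<in> {1..m} \<and>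
     (a = c \<and> (d = Suc b \<or> b = Suc d) \<or> b = d \<and> (c = Suc a \<or> a = Suc c))"
  by (auto simp: cartesian_product_def path_graph_def)

lemma parcs_grid_commute: "(u, v) \<in> parcs (grid n m) \<longleftrightarrow> (v, u) \<in> parcs (grid n m)"
  by (cases u; cases v) (auto simp: parcs_grid)

section \<open>Edge directions as fourth roots of unity, and turns between them\<close>

definition unit_dir :: "complex set" where "unit_dir = {1, -1, \<i>, -\<i>}"

lemma grid_pos_diff:
  "((a, b), (c, d)) \<in> parcs (grid n m) \<Longrightarrow> grid_pos (c, d) - grid_pos (a, b) \<in> unit_dir"
  by (auto simp: parcs_grid grid_pos_def unit_dir_def complex_eq_iff)

lemma Arg2pi_quarter_turns:
  "Arg2pi \<i> = pi / 2" "Arg2pi (-1) = pi" "Arg2pi (-\<i>) = 3 * pi / 2"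
proof -
  have quarter: "exp (\<i> * of_real (pi / 2)) = \<i>"
    unfolding exp_Euler cos_of_real sin_of_real by simp
  show "Arg2pi \<i> = pi / 2"
    by (rule Arg2pi_unique[of 1]) (use quarter in auto)
  show "Arg2pi (-1) = pi"
    by (rule Arg2pi_unique[of 1]) (auto simp: exp_Euler complex_eq_iff cos_of_real sin_of_real)
  have "exp (\<i> * of_real (3 * pi / 2)) = exp (\<i> * of_real pi) * exp (\<i> * of_real (pi / 2))"
    unfolding exp_add[symmetric] by (rule arg_cong[where f = exp]) (simp add: field_simps)
  also have "\<dots> = -\<i>" unfolding quarter by (simp add: exp_Euler)
  finally show "Arg2pi (-\<i>) = 3 * pi / 2"
    by (intro Arg2pi_unique[of 1]) auto
qed

text \<open>Multiplication by \<open>-\<i>\<close> is a clockwise quarter turn, so the quotient in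
  \<open>clockwise_angle\<close> is \<open>\<i> ^ k\<close>. The exponent ranges over 1 to 4 rather
  than 0 to 3 because turning back counts as a full turn.\<close>

lemma clockwise_angle_turn:
  assumes a: "grid_pos u - grid_pos v \<in> unit_dir"
    and k: "k \<in> {1..4}" and w: "grid_pos w - grid_pos v = (-\<i>) ^ k * (grid_pos u - grid_pos v)"
  shows "clockwise_angle grid_pos u v w = real k * pi / 2"
proof -
  have nz: "grid_pos u - grid_pos v \<noteq> 0" using a by (auto simp: unit_dir_def)
  have "w = u \<longleftrightarrow> grid_pos w - grid_pos v = grid_pos u - grid_pos v"
    by (cases w; cases u) (auto simp: grid_pos_def)
  then have eq: "w = u \<longleftrightarrow> (-\<i>) ^ k = 1"
    using nz by (simp add: w)
  have "inverse ((-\<i>) ^ k) = \<i> ^ k"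
    by (simp flip: power_inverse)
  then have "(grid_pos u - grid_pos v) / (grid_pos w - grid_pos v) = \<i> ^ k"
    unfolding w using nz by (simp add: divide_inverse mult.commute[of _ "grid_pos u - grid_pos v"] flip: mult.assoc)
  moreover have neq: "-\<i> \<noteq> 1" "\<i> \<noteq> -1" by (simp_all add: complex_eq_iff)
  moreover have "k = 1 \<or> k = 2 \<or> k = 3 \<or> k = 4" using k by auto
  ultimately show ?thesis
    unfolding clockwise_angle_def eq
    by (elim disjE)
      (auto simp: Arg2pi_quarter_turns power2_eq_square power3_eq_cube power4_eq_xxxx
        neq)
qed

lemma unit_dir_turn:
  assumes "a \<in> unit_dir" "b \<in> unit_dir"
  obtains k where "k \<in> {1..4}" "b = (-\<i>) ^ k * a"
proof -
  have "\<exists>k\<in>{1, 2, 3, 4::nat}. b = (-\<i>) ^ k * a"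
    using assms by (auto simp: unit_dir_def power2_eq_square power3_eq_cube power4_eq_xxxx)
  then obtain k where "k \<in> {1, 2, 3, 4::nat}" "b = (-\<i>) ^ k * a" by blast
  then show ?thesis by (intro that[of k]) auto
qed

text \<open>Comparing clockwise angles amounts to comparing exponents of \<open>-\<i>\<close>: the
  arc to \<open>x\<close> bounds the exponent of \<open>w\<close> by \<open>k\<close>, and
  \<open>no\<close> excludes everything smaller.\<close>

lemma boundary_successor_grid:
  assumes uv: "(u, v) \<in> parcs (grid n m)" and x: "(v, x) \<in> parcs (grid n m)"
    and succ: "boundary_successor (grid n m) grid_pos u v w"
    and k: "k \<in> {1..4}" and xk: "grid_pos x - grid_pos v = (-\<i>) ^ k * (grid_pos u - grid_pos v)"
    and no: "\<And>j y. j \<in> {1..<k} \<Longrightarrow> (v, y) \<in> parcs (grid n m) \<Longrightarrow>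
      grid_pos y - grid_pos v \<noteq> (-\<i>) ^ j * (grid_pos u - grid_pos v)"
  shows "w = x"
proof -
  have dir: "grid_pos y - grid_pos v \<in> unit_dir" if "(v, y) \<in> parcs (grid n m)" for y
    using that by (cases v; cases y) (simp add: grid_pos_diff)
  have vw: "(v, w) \<in> parcs (grid n m)" using succ by (simp add: boundary_successor_def)
  have u: "grid_pos u - grid_pos v \<in> unit_dir"
    using uv dir parcs_grid_commute by blast
  obtain j where j: "j \<in> {1..4}" "grid_pos w - grid_pos v = (-\<i>) ^ j * (grid_pos u - grid_pos v)"
    using unit_dir_turn[OF u dir[OF vw]] .
  have "real j * pi / 2 \<le> real k * pi / 2"
    using succ x clockwise_angle_turn[OF u j] clockwise_angle_turn[OF u k xk]
    unfolding boundary_successor_def by metis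
  then have "j \<le> k" by simp
  moreover have "\<not> j < k" using no[of j w] j vw by auto
  ultimately have "grid_pos w - grid_pos v = grid_pos x - grid_pos v" using j(2) xk by simp
  then have "grid_pos w = grid_pos x" by (metis diff_add_cancel)
  then show ?thesis by (cases w; cases x) (simp add: grid_pos_def)
qed

text \<open>Counter-clockwise, so that the square is on the left, and periodic in \<open>k\<close>,
  so that it describes walks of any length.\<close>

definition corner :: "nat \<Rightarrow> nat \<Rightarrow> nat \<Rightarrow> nat \<times> nat" where
  "corner i j k = (if k mod 4 = 0 then (i, j) else if k mod 4 = 1 then (Suc i, j)
     else if k mod 4 = 2 then (Suc i, Suc j) else (i, Suc j))"

definition outer_vertices :: "nat \<Rightarrow> nat \<Rightarrow> (nat \<times> nat) set" where
  "outer_vertices n m = {(x, y). x \<in> {1..n} \<and> y \<in> {1..m} \<and> (x = 1 \<or> x = n \<or> y = 1 \<or> y = m)}"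

text \<open>Clockwise, so that the outer face is on the left.\<close>

definition outer_next :: "nat \<Rightarrow> nat \<Rightarrow> nat \<times> nat \<Rightarrow> nat \<times> nat" where
  "outer_next n m = (\<lambda>(x, y). if x = 1 \<and> y < m then (1, Suc y) else if y = m \<and> x < n then (Suc x, y)
     else if x = n \<and> 1 < y then (x, y - 1) else (x - 1, y))"

text \<open>
  The cycle starts at \<open>(1, 2)\<close> because vertex \<open>0\<close> receives a colour that no other outer vertex
  has; this separates the neighbours \<open>(1, 2)\<close> and \<open>(2, 1)\<close> of \<open>(2, 2)\<close>.
\<close>

definition outer_cycle :: "nat \<Rightarrow> nat \<Rightarrow> nat \<Rightarrow> nat \<times> nat" where
  "outer_cycle n m k = (outer_next n m ^^ k) (1, 2)"

section \<open>The successor rule around unit squares and along the outer cycle\<close>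

lemma mod_4_cases:
  fixes k :: nat
  obtains "k mod 4 = 0" | "k mod 4 = 1" | "k mod 4 = 2" | "k mod 4 = 3"
proof -
  have "k mod 4 = 0 \<or> k mod 4 = 1 \<or> k mod 4 = 2 \<or> k mod 4 = 3" by arith
  then show ?thesis using that by (elim disjE)
qed

lemma corner_Suc:
  "k mod 4 = 0 \<Longrightarrow> corner i j (Suc k) = (Suc i, j)"
  "k mod 4 = 1 \<Longrightarrow> corner i j (Suc k) = (Suc i, Suc j)"
  "k mod 4 = 2 \<Longrightarrow> corner i j (Suc k) = (i, Suc j)"
  "k mod 4 = 3 \<Longrightarrow> corner i j (Suc k) = (i, j)"
  by (simp_all add: corner_def mod_Suc)

lemma corner_eq:
  "k mod 4 = 0 \<Longrightarrow> corner i j k = (i, j)"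
  "k mod 4 = 1 \<Longrightarrow> corner i j k = (Suc i, j)"
  "k mod 4 = 2 \<Longrightarrow> corner i j k = (Suc i, Suc j)"
  "k mod 4 = 3 \<Longrightarrow> corner i j k = (i, Suc j)"
  by (simp_all add: corner_def)

text \<open>The next side of the square is a single clockwise quarter turn away, the smallest turn
  there is, so no other edge can precede it.\<close>

lemma boundary_successor_corner:
  assumes ij: "i \<in> {1..<n}" "j \<in> {1..<m}"
    and succ: "boundary_successor (grid n m) grid_pos (corner i j k) (corner i j (Suc k)) w"
  shows "w = corner i j (Suc (Suc k))"
proof (rule boundary_successor_grid[OF _ _ succ, where k = 1])
  show "(corner i j k, corner i j (Suc k)) \<in> parcs (grid n m)"
    by (cases k rule: mod_4_cases) (use ij in \<open>auto simp: corner_eq corner_Suc parcs_grid\<close>)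
  show "(corner i j (Suc k), corner i j (Suc (Suc k))) \<in> parcs (grid n m)"
    by (cases k rule: mod_4_cases) (use ij in \<open>auto simp: corner_def mod_Suc parcs_grid\<close>)
  show "grid_pos (corner i j (Suc (Suc k))) - grid_pos (corner i j (Suc k)) =
      (-\<i>) ^ 1 * (grid_pos (corner i j k) - grid_pos (corner i j (Suc k)))"
    by (cases k rule: mod_4_cases)
      (auto simp: corner_def mod_Suc grid_pos_def complex_eq_iff)
qed auto

text \<open>The cases alternate between going straight along a side and turning at a corner, in the
  order left, top, right, bottom. Coordinates are parametrized so that all three vertices are given
  by sums, without truncated subtraction.\<close>

lemma outer_next_cases:
  assumes "n \<ge> 3" "m \<ge> 3" "u \<in> outer_vertices n m"
  obtains
    b where "1 \<le> b" "b + 2 \<le> m" "u = (1, b)" "outer_next n m u = (1, b + 1)"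
      "outer_next n m (outer_next n m u) = (1, b + 2)"
  | b where "1 \<le> b" "b + 1 = m" "u = (1, b)" "outer_next n m u = (1, b + 1)"
      "outer_next n m (outer_next n m u) = (2, b + 1)"
  | a where "1 \<le> a" "a + 2 \<le> n" "u = (a, m)" "outer_next n m u = (a + 1, m)"
      "outer_next n m (outer_next n m u) = (a + 2, m)"
  | a b where "1 \<le> a" "1 \<le> b" "a + 1 = n" "b + 1 = m" "u = (a, b + 1)"
      "outer_next n m u = (a + 1, b + 1)" "outer_next n m (outer_next n m u) = (a + 1, b)"
  | b where "1 \<le> b" "b + 2 \<le> m" "u = (n, b + 2)" "outer_next n m u = (n, b + 1)"
      "outer_next n m (outer_next n m u) = (n, b)"
  | a where "1 \<le> a" "a + 1 = n" "u = (a + 1, 2)" "outer_next n m u = (a + 1, 1)"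
      "outer_next n m (outer_next n m u) = (a, 1)"
  | a where "1 \<le> a" "a + 2 \<le> n" "u = (a + 2, 1)" "outer_next n m u = (a + 1, 1)"
      "outer_next n m (outer_next n m u) = (a, 1)"
  | "u = (2, 1)" "outer_next n m u = (1, 1)" "outer_next n m (outer_next n m u) = (1, 2)"
proof -
  obtain a b where ab: "u = (a, b)" by fastforce
  have range: "1 \<le> a" "a \<le> n" "1 \<le> b" "b \<le> m"
    using assms by (auto simp: ab outer_vertices_def)
  have "a = 1 \<or> a = n \<or> b = 1 \<or> b = m"
    using assms by (simp add: ab outer_vertices_def)
  then consider "a = 1" "b < m" | "b = m" "a < n" | "a = n" "1 < b" | "b = 1" "1 < a"
    using assms range by (metis le_neq_implies_less numeral_le_one_iff semiring_norm(70))
  then show ?thesis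
  proof cases
    case 1
    show ?thesis
    proof (cases "b + 2 \<le> m")
      case True
      then show ?thesis using that(1)[of b] assms range 1 by (simp add: ab outer_next_def)
    next
      case False
      then show ?thesis using that(2)[of b] assms range 1 by (simp add: ab outer_next_def)
    qed
  next
    case 2
    show ?thesis
    proof (cases "a + 2 \<le> n")
      case True
      then show ?thesis using that(3)[of a] assms range 2 by (simp add: ab outer_next_def)
    next
      case False
      then show ?thesis using that(4)[of a "b - 1"] assms range 2 by (simp add: ab outer_next_def)
    qed
  next
    case 3
    show ?thesis
    proof (cases "3 \<le> b")
      case True
      then show ?thesis using that(5)[of "b - 2"] assms range 3 by (simp add: ab outer_next_def)
    next
      case False
      then show ?thesis using that(6)[of "a - 1"] assms range 3 by (simp add: ab outer_next_def)
    qed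
  next
    case 4
    show ?thesis
    proof (cases "3 \<le> a")
      case True
      then show ?thesis using that(7)[of "a - 2"] assms range 4 by (simp add: ab outer_next_def)
    next
      case False
      then show ?thesis using that(8) assms range 4 by (simp add: ab outer_next_def)
    qed
  qed
qed

text \<open>With the outer face on the left, the first clockwise quarter turn would leave the grid.
  Along a side the walk therefore goes straight on (\<open>k = 2\<close>); at a corner that edge is
  missing too, and it turns right (\<open>k = 3\<close>).\<close>

lemma boundary_successor_outer:
  assumes nm: "n \<ge> 3" "m \<ge> 3" and u: "u \<in> outer_vertices n m"
    and succ: "boundary_successor (grid n m) grid_pos u (outer_next n m u) w"
  shows "w = outer_next n m (outer_next n m u)"
proof -
  have straight: "w = x"
    if arcs: "(u, v) \<in> parcs (grid n m)" "(v, x) \<in> parcs (grid n m)"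
      "boundary_successor (grid n m) grid_pos u v w"
      "grid_pos x - grid_pos v = grid_pos v - grid_pos u"
      and noarc: "\<And>c d. (v, (c, d)) \<in> parcs (grid n m) \<Longrightarrow>
        grid_pos (c, d) - grid_pos v \<noteq> -\<i> * (grid_pos u - grid_pos v)" for u v x
  proof (rule boundary_successor_grid[OF arcs(1-3), where k = 2])
    show "grid_pos y - grid_pos v \<noteq> (-\<i>) ^ j * (grid_pos u - grid_pos v)"
      if j: "j \<in> {1..<2}" and y: "(v, y) \<in> parcs (grid n m)" for j y
    proof -
      have "j = 1" using j by auto
      then show ?thesis using noarc[of "fst y" "snd y"] y by simp
    qed
  qed (use arcs(4) in \<open>simp_all add: power2_eq_square\<close>)
  have right: "w = x"
    if arcs: "(u, v) \<in> parcs (grid n m)" "(v, x) \<in> parcs (grid n m)"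
      "boundary_successor (grid n m) grid_pos u v w"
      "grid_pos x - grid_pos v = \<i> * (grid_pos u - grid_pos v)"
      and noarc: "\<And>c d. (v, (c, d)) \<in> parcs (grid n m) \<Longrightarrow>
        grid_pos (c, d) - grid_pos v \<noteq> -\<i> * (grid_pos u - grid_pos v) \<and>
        grid_pos (c, d) - grid_pos v \<noteq> grid_pos v - grid_pos u" for u v x
  proof (rule boundary_successor_grid[OF arcs(1-3), where k = 3])
    show "grid_pos y - grid_pos v \<noteq> (-\<i>) ^ j * (grid_pos u - grid_pos v)"
      if j: "j \<in> {1..<3}" and y: "(v, y) \<in> parcs (grid n m)" for j y
    proof -
      have "j = 1 \<or> j = 2" using j by auto
      then show ?thesis using noarc[of "fst y" "snd y"] y
        by (auto simp: power2_eq_square)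
    qed
  qed (use arcs(4) in \<open>simp_all add: power3_eq_cube\<close>)
  note simps = parcs_grid grid_pos_def complex_eq_iff
  show ?thesis
    using nm u
  proof (cases rule: outer_next_cases)
    case (1 b)
    show ?thesis
      by (rule straight[OF _ _ succ]; use 1 nm in \<open>auto simp: simps\<close>)
  next
    case (2 b)
    show ?thesis
      unfolding 2(5)
      using succ unfolding 2(3,4)
      by (rule right[rotated 2]) (use 2 nm in \<open>auto simp: simps simp flip: 2(2)\<close>)
  next
    case (3 a)
    show ?thesis
      by (rule straight[OF _ _ succ]; use 3 nm in \<open>auto simp: simps\<close>)
  next
    case (4 a b)
    show ?thesis
      unfolding 4(7)
      using succ unfolding 4(5,6)
      by (rule right[rotated 2]) (use 4 nm in \<open>auto simp: simps simp flip: 4(3,4)\<close>)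
  next
    case (5 b)
    show ?thesis
      by (rule straight[OF _ _ succ]; use 5 nm in \<open>auto simp: simps\<close>)
  next
    case (6 a)
    show ?thesis
      unfolding 6(5)
      using succ unfolding 6(3,4)
      by (rule right[rotated 2]) (use 6 nm in \<open>auto simp: simps simp flip: 6(2)\<close>)
  next
    case (7 a)
    show ?thesis
      by (rule straight[OF _ _ succ]; use 7 nm in \<open>auto simp: simps\<close>)
  next
    case 8
    show ?thesis
      by (rule right[OF _ _ succ]; use 8 nm in \<open>auto simp: simps\<close>)
  qed
qed

text \<open>What lies to the left of an arc is a unit square, unless the arc runs clockwise on the
  outer cycle. Arcs going right, up, left and down are the sides 0, 1, 2 and 3 of that
  square.\<close>

lemma parcs_grid_cases:
  assumes "n \<ge> 3" "m \<ge> 3" "(u, v) \<in> parcs (grid n m)"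
  obtains i j k where "i \<in> {1..<n}" "j \<in> {1..<m}" "u = corner i j k" "v = corner i j (Suc k)"
  | "u \<in> outer_vertices n m" "v = outer_next n m u"
proof -
  obtain a b c d where uv: "u = (a, b)" "v = (c, d)" by fastforce
  note inner = that(1) and outer = that(2)
  consider "b = d" "c = Suc a" | "a = c" "d = Suc b" | "b = d" "a = Suc c" | "a = c" "b = Suc d"
    using assms by (auto simp: uv parcs_grid)
  then show ?thesis
  proof cases
    case 1
    show ?thesis
    proof (cases "b = m")
      case True
      then show ?thesis
        by (intro outer)
          (use assms 1 in \<open>auto simp: uv parcs_grid outer_next_def outer_vertices_def\<close>)
    next
      case False
      then show ?thesis
        by (intro inner[of a b 0])
          (use assms 1 in \<open>auto simp: uv parcs_grid corner_def\<close>)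
    qed
  next
    case 2
    show ?thesis
    proof (cases "a = 1")
      case True
      then show ?thesis
        by (intro outer)
          (use assms 2 in \<open>auto simp: uv parcs_grid outer_next_def outer_vertices_def\<close>)
    next
      case False
      then show ?thesis
        by (intro inner[of "a - 1" b 1])
          (use assms 2 in \<open>auto simp: uv parcs_grid corner_def\<close>)
    qed
  next
    case 3
    show ?thesis
    proof (cases "b = 1")
      case True
      then show ?thesis
        by (intro outer)
          (use assms 3 in \<open>auto simp: uv parcs_grid outer_next_def outer_vertices_def\<close>)
    next
      case False
      then show ?thesis
        by (intro inner[of c "b - 1" 2])
          (use assms 3 in \<open>auto simp: uv parcs_grid corner_def\<close>)
    qed
  next
    case 4
    show ?thesis
    proof (cases "a = n")
      case True
      then show ?thesis
        by (intro outer)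
          (use assms 4 in \<open>auto simp: uv parcs_grid outer_next_def outer_vertices_def\<close>)
    next
      case False
      then show ?thesis
        by (intro inner[of a d 3])
          (use assms 4 in \<open>auto simp: uv parcs_grid corner_def\<close>)
    qed
  qed
qed

section \<open>Closed form and bijectivity of the outer cycle\<close>

lemma outer_cycle_Suc: "outer_cycle n m (Suc k) = outer_next n m (outer_cycle n m k)"
  by (simp add: outer_cycle_def)

lemma outer_cycle_side:
  assumes nm: "n \<ge> 3" "m \<ge> 3"
  shows "k + 2 = y \<Longrightarrow> y \<le> m \<Longrightarrow> outer_cycle n m k = (1, y)"
    and "k + 3 = m + x \<Longrightarrow> 1 \<le> x \<Longrightarrow> x \<le> n \<Longrightarrow> outer_cycle n m k = (x, m)"
    and "k + y + 3 = 2 * m + n \<Longrightarrow> 1 \<le> y \<Longrightarrow> y \<le> m \<Longrightarrow> outer_cycle n m k = (n, y)"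
    and "k + x + 4 = 2 * n + 2 * m \<Longrightarrow> 1 \<le> x \<Longrightarrow> x \<le> n \<Longrightarrow> outer_cycle n m k = (x, 1)"
proof -
  have left: "outer_cycle n m k = (1, k + 2)" if "k + 2 \<le> m" for k
    using that
  proof (induction k)
    case (Suc k)
    then show ?case by (simp add: outer_cycle_Suc outer_next_def)
  qed (simp add: outer_cycle_def)
  \<comment> \<open>Each further side starts at the corner where the previous side ended; its
    induction counts the steps from there.\<close>
  have top: "outer_cycle n m (m - 2 + a) = (a + 1, m)" if "a < n" for a
    using that
  proof (induction a)
    case 0
    then show ?case using left[of "m - 2"] nm by simp
  next
    case (Suc a)
    then show ?case by (simp add: outer_cycle_Suc outer_next_def)
  qed
  have right: "outer_cycle n m (m + n - 3 + b) = (n, m - b)" if "b < m" for b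
    using that
  proof (induction b)
    case 0
    then show ?case using top[of "n - 1"] nm by (simp add: eval_nat_numeral)
  next
    case (Suc b)
    then show ?case using nm by (simp add: outer_cycle_Suc outer_next_def)
  qed
  have bottom: "outer_cycle n m (2 * m + n - 4 + c) = (n - c, 1)" if "c < n" for c
    using that
  proof (induction c)
    case 0
    have "m + n - 3 + (m - 1) = 2 * m + n - 4" using nm by simp
    then show ?case using right[of "m - 1"] nm by simp
  next
    case (Suc c)
    then show ?case using nm by (simp add: outer_cycle_Suc outer_next_def)
  qed
  show "outer_cycle n m k = (1, y)" if "k + 2 = y" "y \<le> m"
    using left[of k] that by simp
  show "outer_cycle n m k = (x, m)" if "k + 3 = m + x" "1 \<le> x" "x \<le> n"
  proof -
    have k: "m - 2 + (x - 1) = k" using that nm by simp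
    show ?thesis using top[of "x - 1", unfolded k] that by simp
  qed
  show "outer_cycle n m k = (n, y)" if "k + y + 3 = 2 * m + n" "1 \<le> y" "y \<le> m"
  proof -
    have k: "m + n - 3 + (m - y) = k" using that nm by simp
    show ?thesis using right[of "m - y", unfolded k] that by simp
  qed
  show "outer_cycle n m k = (x, 1)" if "k + x + 4 = 2 * n + 2 * m" "1 \<le> x" "x \<le> n"
  proof -
    have k: "2 * m + n - 4 + (n - x) = k" using that nm by simp
    show ?thesis using bottom[of "n - x", unfolded k] that by simp
  qed
qed

text \<open>Here the sides are half-open, so that every corner belongs to one side only; comparing
  coordinates then yields injectivity.\<close>

lemma outer_cycle_cases:
  assumes nm: "n \<ge> 3" "m \<ge> 3" and k: "k < 2 * n + 2 * m - 4"
  obtains y where "2 \<le> y" "y \<le> m" "k + 2 = y" "outer_cycle n m k = (1, y)"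
  | x where "2 \<le> x" "x \<le> n" "k + 3 = m + x" "outer_cycle n m k = (x, m)"
  | y where "1 \<le> y" "y < m" "k + y + 3 = 2 * m + n" "outer_cycle n m k = (n, y)"
  | x where "1 \<le> x" "x < n" "k + x + 4 = 2 * n + 2 * m" "outer_cycle n m k = (x, 1)"
proof -
  have k: "k + 4 < 2 * n + 2 * m" using k by simp
  show ?thesis
  proof (cases "k + 2 \<le> m")
    case True
    then show ?thesis using that(1)[of "k + 2"] outer_cycle_side(1)[OF nm] by simp
  next
    case k1: False
    show ?thesis
    proof (cases "k + 3 \<le> m + n")
      case True
      then obtain x where x: "k + 3 = m + x" using k1 le_Suc_ex[of m "k + 3"] by force
      then show ?thesis using that(2)[of x] outer_cycle_side(2)[OF nm x] True k1 by simp
    next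
      case k2: False
      show ?thesis
      proof (cases "k + 4 \<le> 2 * m + n")
        case True
        then obtain y where y: "2 * m + n = k + 4 + y" using le_Suc_ex by blast
        then show ?thesis using that(3)[of "y + 1"] outer_cycle_side(3)[OF nm, of k "y + 1"] k2 by simp
      next
        case k3: False
        obtain x where x: "2 * n + 2 * m = k + 5 + x" using k le_Suc_ex[of "k + 5"] by force
        then show ?thesis
          using that(4)[of "x + 1"] outer_cycle_side(4)[OF nm, of k "x + 1"] k3 by simp
      qed
    qed
  qed
qed

lemma outer_next_outer_cycle:
  assumes nm: "n \<ge> 3" "m \<ge> 3" and k: "k < 2 * n + 2 * m - 4"
  shows "outer_next n m (outer_cycle n m k) = outer_cycle n m (Suc k mod (2 * n + 2 * m - 4))"
proof (cases "Suc k = 2 * n + 2 * m - 4")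
  case True
  \<comment> \<open>The last index sits at \<open>(1, 1)\<close>, whose successor is the starting
    point \<open>(1, 2)\<close>.\<close>
  then have "outer_cycle n m k = (1, 1)" "outer_cycle n m 0 = (1, 2)"
    using nm outer_cycle_side(4)[OF nm, of k 1] by (auto simp: outer_cycle_def)
  then show ?thesis using True nm by (simp add: outer_next_def)
next
  case False
  then show ?thesis using k by (simp add: outer_cycle_Suc)
qed

lemma bij_betw_outer_cycle:
  assumes nm: "n \<ge> 3" "m \<ge> 3"
  shows "bij_betw (outer_cycle n m) {..<2 * n + 2 * m - 4} (outer_vertices n m)"
proof (rule bij_betw_imageI)
  show "inj_on (outer_cycle n m) {..<2 * n + 2 * m - 4}"
  proof (rule inj_onI)
    fix k l assume k: "k \<in> {..<2 * n + 2 * m - 4}" and l: "l \<in> {..<2 * n + 2 * m - 4}"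
      and eq: "outer_cycle n m k = outer_cycle n m l"
    show "k = l"
      by (rule outer_cycle_cases[OF nm k[unfolded lessThan_iff]];
          rule outer_cycle_cases[OF nm l[unfolded lessThan_iff]]; use eq nm in simp)
  qed
  show "outer_cycle n m ` {..<2 * n + 2 * m - 4} = outer_vertices n m"
  proof
    show "outer_cycle n m ` {..<2 * n + 2 * m - 4} \<subseteq> outer_vertices n m"
    proof (rule image_subsetI)
      fix k assume "k \<in> {..<2 * n + 2 * m - 4}"
      then have k: "k < 2 * n + 2 * m - 4" by simp
      show "outer_cycle n m k \<in> outer_vertices n m"
        by (rule outer_cycle_cases[OF nm k]; use nm in \<open>simp add: outer_vertices_def\<close>)
    qed
    show "outer_vertices n m \<subseteq> outer_cycle n m ` {..<2 * n + 2 * m - 4}"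
    proof
      fix v assume "v \<in> outer_vertices n m"
      moreover obtain x y where xy: "v = (x, y)" by fastforce
      ultimately have v: "(x, y) \<in> outer_vertices n m" by simp
      note side = outer_cycle_side[OF nm]
      have "\<exists>k < 2 * n + 2 * m - 4. outer_cycle n m k = (x, y)"
      proof -
        consider "x = 1" "2 \<le> y" | "y = m" | "x = n" | "y = 1"
          using v by (auto simp: outer_vertices_def) linarith
        then show ?thesis
        proof cases
          case 1
          then show ?thesis using side(1)[of "y - 2" y] v nm
            by (intro exI[of _ "y - 2"]) (simp add: outer_vertices_def)
        next
          case 2
          then show ?thesis using side(2)[of "m + x - 3" x] v nm
            by (intro exI[of _ "m + x - 3"]) (auto simp: outer_vertices_def)
        next
          case 3
          then show ?thesis using side(3)[of "2 * m + n - 3 - y" y] v nm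
            by (intro exI[of _ "2 * m + n - 3 - y"]) (simp add: outer_vertices_def)
        next
          case 4
          then show ?thesis using side(4)[of "2 * n + 2 * m - 4 - x" x] v nm
            by (intro exI[of _ "2 * n + 2 * m - 4 - x"]) (auto simp: outer_vertices_def)
        qed
      qed
      then show "v \<in> outer_cycle n m ` {..<2 * n + 2 * m - 4}"
        unfolding xy by force
    qed
  qed
qed

section \<open>Facial paths run around a square or along the outer cycle\<close>

lemma boundary_walk_step:
  fixes c :: "'a list"
  defines "f \<equiv> \<lambda>i. c ! (i mod length c)"
  assumes "boundary_walk G pos F c"
  shows "(f i, f (Suc i)) \<in> parcs G" "boundary_successor G pos (f i) (f (Suc i)) (f (Suc (Suc i)))"
proof -
  have "i mod length c < length c" using assms by (simp add: boundary_walk_def)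
  then show "(f i, f (Suc i)) \<in> parcs G"
      "boundary_successor G pos (f i) (f (Suc i)) (f (Suc (Suc i)))"
    using assms(2) unfolding boundary_walk_def f_def Let_def
    by (metis mod_Suc_eq)+
qed

text \<open>The successor rule is deterministic, so the first arc, which lies on a square or on the
  outer cycle, decides the whole walk.\<close>

lemma facial_path_grid:
  assumes nm: "n \<ge> 3" "m \<ge> 3" and p: "facial_path (grid n m) grid_pos p"
  obtains q where "q = p \<or> q = rev p" "distinct q"
    and "(\<exists>i\<in>{1..<n}. \<exists>j\<in>{1..<m}. \<exists>k. \<forall>t<length q. q ! t = corner i j (k + t)) \<or>
      (\<exists>k. \<forall>t<length q. q ! t = outer_cycle n m ((k + t) mod (2 * n + 2 * m - 4)))"
proof -
  let ?N = "2 * n + 2 * m - 4"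
  obtain F c where c: "boundary_walk (grid n m) grid_pos F c"
    and pc: "consecutive_on_cycle p c \<or> consecutive_on_cycle (rev p) c"
    using p unfolding facial_path_def by blast
  obtain q where q: "q = p \<or> q = rev p" "consecutive_on_cycle q c" using pc by blast
  have "distinct p" using p unfolding facial_path_def vpath_def by blast
  then have dist: "distinct q" using q(1) by auto
  obtain s where s: "\<And>t. t < length q \<Longrightarrow> q ! t = c ! ((s + t) mod length c)"
    using q(2) unfolding consecutive_on_cycle_def by blast
  \<comment> \<open>The boundary walk read periodically from the start of \<open>q\<close>, so that
    the successor rule holds at every index.\<close>
  define g where "g = (\<lambda>t. c ! ((s + t) mod length c))"
  have arc: "(g t, g (Suc t)) \<in> parcs (grid n m)"
    and succ: "boundary_successor (grid n m) grid_pos (g t) (g (Suc t)) (g (Suc (Suc t)))" for t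
    using boundary_walk_step[OF c, of "s + t"] by (simp_all add: g_def)
  from nm arc[of 0] have "(\<exists>i\<in>{1..<n}. \<exists>j\<in>{1..<m}. \<exists>k. \<forall>t. g t = corner i j (k + t)) \<or>
      (\<exists>k. \<forall>t. g t = outer_cycle n m ((k + t) mod ?N))"
  proof (cases rule: parcs_grid_cases)
    case (1 i j k)
    \<comment> \<open>The rule takes an arc as input, so the induction carries two consecutive
      vertices.\<close>
    have "g t = corner i j (k + t) \<and> g (Suc t) = corner i j (Suc (k + t))" for t
    proof (induction t)
      case (Suc t)
      then show ?case using boundary_successor_corner[OF 1(1,2), of "k + t"] succ[of t] by simp
    qed (use 1 in simp)
    then show ?thesis using 1(1,2) by blast
  next
    case 2
    have "g 0 \<in> outer_cycle n m ` {..<?N}"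
      using 2(1) bij_betw_outer_cycle[OF nm] by (simp add: bij_betw_def)
    then obtain k where k: "k < ?N" "g 0 = outer_cycle n m k" by auto
    have next_: "outer_next n m (outer_cycle n m (l mod ?N)) = outer_cycle n m (Suc l mod ?N)" for l
      using outer_next_outer_cycle[OF nm, of "l mod ?N"] nm by (simp add: mod_Suc_eq)
    have on: "outer_cycle n m (l mod ?N) \<in> outer_vertices n m" for l
      using bij_betwE[OF bij_betw_outer_cycle[OF nm]] nm by simp
    have "g t = outer_cycle n m ((k + t) mod ?N) \<and> g (Suc t) = outer_next n m (g t)" for t
    proof (induction t)
      case (Suc t)
      then show ?case
        using boundary_successor_outer[OF nm, of "g t" "g (Suc (Suc t))"] succ[of t]
          on[of "k + t"] next_[of "k + t"] by simp
    qed (use k 2 in simp)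
    then show ?thesis by blast
  qed
  moreover have "q ! t = g t" if "t < length q" for t using s[OF that] by (simp add: g_def)
  ultimately show ?thesis by (intro that[OF q(1) dist]) fastforce
qed

lemma repetition_rev:
  assumes "repetition r"
  shows "repetition (rev r)"
proof -
  obtain n where n: "n \<ge> 1" "length r = 2 * n" "\<And>i. i < n \<Longrightarrow> r ! i = r ! (n + i)"
    using assms unfolding repetition_def by auto
  have "rev r ! i = rev r ! (n + i)" if "i < n" for i
  proof -
    have "rev r ! i = r ! (n + (n - Suc i))" using that n(2) by (simp add: rev_nth mult_2)
    also have "\<dots> = r ! (n - Suc i)" using n(3)[of "n - Suc i"] that by simp
    also have "\<dots> = rev r ! (n + i)" using that n(2) by (simp add: rev_nth)
    finally show ?thesis .
  qed
  then show ?thesis using n unfolding repetition_def by auto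
qed

text \<open>
  On a unit square, excluding monochromatic edges and two simultaneously monochromatic diagonals
  excludes all repetitions, as paths there have at most four vertices.
\<close>

definition square_proper :: "nat \<Rightarrow> nat \<Rightarrow> (nat \<times> nat) set \<Rightarrow> (nat \<times> nat \<Rightarrow> 'a) \<Rightarrow> bool" where
  "square_proper n m S \<phi> \<longleftrightarrow>
     (\<forall>u\<in>S. \<forall>v\<in>S. (u, v) \<in> parcs (grid n m) \<longrightarrow> \<phi> u \<noteq> \<phi> v) \<and>
     (\<forall>i\<in>{1..<n}. \<forall>j\<in>{1..<m}. {(i, j), (Suc i, j), (Suc i, Suc j), (i, Suc j)} \<subseteq> S \<longrightarrow>
       \<not> (\<phi> (i, j) = \<phi> (Suc i, Suc j) \<and> \<phi> (Suc i, j) = \<phi> (i, Suc j)))"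

text \<open>As a path has distinct vertices, it has at most four on a square and at most
  \<open>2 * n + 2 * m - 4\<close> on the outer cycle. A repetition on a square is thus a
  monochromatic edge or makes both diagonals monochromatic.\<close>

lemma facial_nonrepetitive_gridI:
  assumes nm: "n \<ge> 3" "m \<ge> 3"
    and proper: "square_proper n m ({1..n} \<times> {1..m}) \<phi>"
    and outer: "\<And>t k. 1 \<le> k \<Longrightarrow> 2 * k \<le> 2 * n + 2 * m - 4 \<Longrightarrow>
      \<exists>i<k. \<phi> (outer_cycle n m ((t + i) mod (2 * n + 2 * m - 4))) \<noteq>
        \<phi> (outer_cycle n m ((t + k + i) mod (2 * n + 2 * m - 4)))"
  shows "facial_nonrepetitive (grid n m) grid_pos \<phi>"
  unfolding facial_nonrepetitive_def
proof (intro allI impI notI)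
  let ?N = "2 * n + 2 * m - 4"
  fix p assume "facial_path (grid n m) grid_pos p" and rep: "repetition (map \<phi> p)"
  from nm this(1) obtain q where q: "q = p \<or> q = rev p" "distinct q"
    and walk: "(\<exists>i\<in>{1..<n}. \<exists>j\<in>{1..<m}. \<exists>k. \<forall>t<length q. q ! t = corner i j (k + t)) \<or>
      (\<exists>k. \<forall>t<length q. q ! t = outer_cycle n m ((k + t) mod ?N))"
    by (rule facial_path_grid)
  have "repetition (map \<phi> q)" using q(1) rep repetition_rev[OF rep] by (auto simp: rev_map)
  then obtain k where k: "k \<ge> 1" "length q = 2 * k"
    and sq: "\<And>i. i < k \<Longrightarrow> \<phi> (q ! i) = \<phi> (q ! (k + i))"
    unfolding repetition_def by auto
  have diff: "q ! 0 \<noteq> q ! i" if "0 < i" "i < 2 * k" for i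
    using q(2) k that by (simp add: nth_eq_iff_index_eq)
  from walk show False
  proof (elim disjE bexE exE)
    fix i j s assume ij: "i \<in> {1..<n}" "j \<in> {1..<m}"
      and c: "\<forall>t<length q. q ! t = corner i j (s + t)"
    have "\<not> 4 < 2 * k"
    proof
      assume "4 < 2 * k"
      moreover have "corner i j (s + 4) = corner i j s" by (simp add: corner_def)
      ultimately show False using diff[of 4] c k(2) by simp
    qed
    then consider "k = 1" | "k = 2" using k(1) by linarith
    then show False
    proof cases
      case 1
      have "\<phi> (corner i j s) = \<phi> (corner i j (Suc s))" using sq[of 0] c k 1 by simp
      moreover have "(corner i j s, corner i j (Suc s)) \<in> parcs (grid n m)"
        by (cases s rule: mod_4_cases) (use ij in \<open>auto simp: corner_eq corner_Suc parcs_grid\<close>)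
      moreover have "corner i j l \<in> {1..n} \<times> {1..m}" for l
        using ij by (auto simp: corner_def)
      ultimately show False using proper unfolding square_proper_def by blast
    next
      case 2
      have "\<phi> (corner i j s) = \<phi> (corner i j (Suc (Suc s)))"
        "\<phi> (corner i j (Suc s)) = \<phi> (corner i j (Suc (Suc (Suc s))))"
        using sq[of 0] sq[of 1] c k 2 by (simp_all add: eval_nat_numeral)
      then have "\<phi> (i, j) = \<phi> (Suc i, Suc j) \<and> \<phi> (Suc i, j) = \<phi> (i, Suc j)"
        by (cases s rule: mod_4_cases) (simp_all add: corner_def mod_Suc)
      moreover have "{(i, j), (Suc i, j), (Suc i, Suc j), (i, Suc j)} \<subseteq> {1..n} \<times> {1..m}"
        using ij by auto
      ultimately show False using proper ij unfolding square_proper_def by blast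
    qed
  next
    fix s assume c: "\<forall>t<length q. q ! t = outer_cycle n m ((s + t) mod ?N)"
    have "\<not> ?N < 2 * k"
    proof
      assume less: "?N < 2 * k"
      then have "q ! ?N = q ! 0" using c k(2) by (metis add_0_right gr_implies_not0 gr0I mod_add_self2)
      then show False using diff[OF _ less] nm by simp
    qed
    then obtain i where "i < k"
      "\<phi> (outer_cycle n m ((s + i) mod ?N)) \<noteq> \<phi> (outer_cycle n m ((s + k + i) mod ?N))"
      using outer[OF k(1), of s] by (auto simp: not_less)
    then show False using sq[of i] c k by (simp add: add.assoc)
  qed
qed

section \<open>Colouring the grid\<close>

text \<open>The colours \<open>r\<close>, \<open>u\<close>, \<open>l\<close>, \<open>b\<close>
  belong to the neighbours in cyclic order, and \<open>d1\<close> to \<open>d4\<close> to the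
  opposite corners of the squares between them. If the neighbours do not all agree, at most two
  cyclically adjacent pairs coincide, and each coincidence saves a neighbour colour for the corner
  colour that it forbids, so at most four colours are excluded.\<close>

lemma free_colour_grid_vertex:
  assumes A: "finite A" "5 \<le> card A" and ne: "\<not> (r = u \<and> u = l \<and> l = b)"
  obtains x where "x \<in> A" "x \<notin> {r, u, l, b}" "r = u \<longrightarrow> x \<noteq> d1" "u = l \<longrightarrow> x \<noteq> d2"
    "l = b \<longrightarrow> x \<noteq> d3" "b = r \<longrightarrow> x \<noteq> d4"
proof -
  let ?F = "{r, u, l, b} \<union> (if r = u then {d1} else {}) \<union> (if u = l then {d2} else {}) \<union>
    (if l = b then {d3} else {}) \<union> (if b = r then {d4} else {})"
  have card4: "card {w, x, y, z} \<le> 4" for w x y z :: 'a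
    by (simp add: card_insert_if)
  have "\<exists>w x y z. ?F \<subseteq> {w, x, y, z}"
  proof (cases "r = u")
    case True
    show ?thesis
    proof (cases "l = b")
      case True
      then have "?F \<subseteq> {r, l, d1, d3}" using \<open>r = u\<close> ne by auto
      then show ?thesis by blast
    next
      case False
      then have "?F \<subseteq> {r, l, b, d1} \<or> ?F \<subseteq> {r, b, d1, d2} \<or> ?F \<subseteq> {r, l, d1, d4}"
        using \<open>r = u\<close> ne by (cases "u = l"; cases "b = r") auto
      then show ?thesis by blast
    qed
  next
    case False
    then have "?F \<subseteq> {r, u, l, b} \<or> ?F \<subseteq> {r, u, b, d2} \<or> ?F \<subseteq> {r, u, l, d3} \<or> ?F \<subseteq> {r, u, l, d4} \<or>
      ?F \<subseteq> {r, u, d2, d3} \<or> ?F \<subseteq> {r, u, d2, d4} \<or> ?F \<subseteq> {r, u, d3, d4}"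
      by (cases "u = l"; cases "l = b"; cases "b = r") auto
    then show ?thesis by blast
  qed
  then obtain w x y z where F: "?F \<subseteq> {w, x, y, z}" by blast
  have "card ?F \<le> 4" using card_mono[OF _ F] card4[of w x y z] by simp
  then have "\<not> A \<subseteq> ?F" using A card_mono[of ?F A] by (auto simp del: Un_insert_left Un_insert_right)
  then obtain x where "x \<in> A" "x \<notin> ?F" by blast
  then show ?thesis using that[of x] by (simp split: if_splits)
qed

lemma square_proper_extend:
  fixes \<phi> :: "nat \<times> nat \<Rightarrow> nat"
  assumes S: "square_proper n m S \<phi>" and v: "(Suc a, Suc b) \<notin> S"
    and A: "finite A" "5 \<le> card A"
    and ne: "(a, Suc b) \<notin> S \<or> (Suc a, b) \<notin> S \<or> \<phi> (a, Suc b) \<noteq> \<phi> (Suc a, b)"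
  obtains x where "x \<in> A"
    "square_proper n m (insert (Suc a, Suc b) S) (\<phi>((Suc a, Suc b) := x))"
proof -
  \<comment> \<open>If the left or the lower neighbour is uncoloured, it gets a dummy colour
    different from that of the other one, so that the four colours never all agree.\<close>
  have "\<exists>l b'. ((a, Suc b) \<in> S \<longrightarrow> l = \<phi> (a, Suc b)) \<and> ((Suc a, b) \<in> S \<longrightarrow> b' = \<phi> (Suc a, b)) \<and> l \<noteq> b'"
    using ne by (metis n_not_Suc_n)
  then obtain l b' where l: "(a, Suc b) \<in> S \<Longrightarrow> \<phi> (a, Suc b) = l"
    and b': "(Suc a, b) \<in> S \<Longrightarrow> \<phi> (Suc a, b) = b'" and "l \<noteq> b'" by blast
  \<comment> \<open>These values are taken from \<open>\<phi>\<close> even at uncoloured vertices,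
    which can only exclude more colours.\<close>
  define r u where "r = \<phi> (Suc (Suc a), Suc b)" and "u = \<phi> (Suc a, Suc (Suc b))"
  have "\<not> (r = u \<and> u = l \<and> l = b')" using \<open>l \<noteq> b'\<close> by simp
  from A this obtain x where x: "x \<in> A" "x \<notin> {r, u, l, b'}"
    and diag: "r = u \<longrightarrow> x \<noteq> \<phi> (Suc (Suc a), Suc (Suc b))" "u = l \<longrightarrow> x \<noteq> \<phi> (a, Suc (Suc b))"
      "l = b' \<longrightarrow> x \<noteq> \<phi> (a, b)" "b' = r \<longrightarrow> x \<noteq> \<phi> (Suc (Suc a), b)"
    by (rule free_colour_grid_vertex)
  let ?v = "(Suc a, Suc b)" and ?\<psi> = "\<phi>((Suc a, Suc b) := x)"
  have nbr: "\<phi> w \<noteq> x" if "w \<in> S" "(?v, w) \<in> parcs (grid n m)" for w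
    using that x(2) l b' by (cases w) (auto simp: parcs_grid r_def u_def)
  have loop: "(w, w) \<notin> parcs (grid n m)" for w
    by (cases w) (simp add: parcs_grid)
  have "square_proper n m (insert ?v S) ?\<psi>"
    unfolding square_proper_def
  proof (intro conjI ballI impI)
    fix p q assume p: "p \<in> insert ?v S" and q: "q \<in> insert ?v S"
      and pq: "(p, q) \<in> parcs (grid n m)"
    then have qp: "(q, p) \<in> parcs (grid n m)" using parcs_grid_commute by blast
    consider "p \<in> S" "q \<in> S" | "p = ?v" "q \<in> S" | "p \<in> S" "q = ?v" using p q pq loop by blast
    then show "?\<psi> p \<noteq> ?\<psi> q"
    proof cases
      case 1
      then have "p \<noteq> ?v" "q \<noteq> ?v" using v by auto
      then show ?thesis using S 1 pq unfolding square_proper_def by simp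
    next
      case 2
      then have "q \<noteq> ?v" using v by auto
      then show ?thesis using nbr[of q] 2 pq by simp
    next
      case 3
      then have "p \<noteq> ?v" using v by auto
      then show ?thesis using nbr[of p] 3 qp by simp
    qed
  next
    fix i j assume ij: "i \<in> {1..<n}" "j \<in> {1..<m}"
      and sub: "{(i, j), (Suc i, j), (Suc i, Suc j), (i, Suc j)} \<subseteq> insert ?v S"
    \<comment> \<open>Either the square misses the new vertex, or that vertex is its lower left,
      lower right, upper right or upper left corner, matching the four conditions in
      \<open>diag\<close>.\<close>
    consider "?v \<notin> {(i, j), (Suc i, j), (Suc i, Suc j), (i, Suc j)}"
      | "i = Suc a" "j = Suc b" | "i = a" "j = Suc b" | "i = a" "j = b" | "i = Suc a" "j = b"
      by auto
    then show "\<not> (?\<psi> (i, j) = ?\<psi> (Suc i, Suc j) \<and> ?\<psi> (Suc i, j) = ?\<psi> (i, Suc j))"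
    proof cases
      case 1
      then have "{(i, j), (Suc i, j), (Suc i, Suc j), (i, Suc j)} \<subseteq> S" using sub by blast
      then have "\<not> (\<phi> (i, j) = \<phi> (Suc i, Suc j) \<and> \<phi> (Suc i, j) = \<phi> (i, Suc j))"
        using S ij unfolding square_proper_def by blast
      then show ?thesis using 1 by auto
    next
      case 2
      then show ?thesis using diag(1) by (auto simp: r_def u_def)
    next
      case 3
      then show ?thesis using diag(2) sub l by (auto simp: r_def u_def)
    next
      case 4
      then show ?thesis using diag(3) sub l b' by auto
    next
      case 5
      then show ?thesis using diag(4) sub b' by (auto simp: r_def u_def)
    qed
  qed
  then show ?thesis using that x(1) by blast
qed

text \<open>
  The interior vertices are coloured by decreasing coordinate sum, so that the left and the lower
  neighbour of a vertex are both coloured before it only at \<open>(2, 2)\<close>.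
\<close>

lemma square_proper_interior:
  fixes \<phi>0 :: "nat \<times> nat \<Rightarrow> nat"
  assumes base: "square_proper n m (outer_vertices n m) \<phi>0" and ne: "\<phi>0 (1, 2) \<noteq> \<phi>0 (2, 1)"
    and A: "\<And>v. v \<in> {1..n} \<times> {1..m} \<Longrightarrow> finite (A v) \<and> 5 \<le> card (A v)"
    and T: "finite T" "T \<subseteq> {1..n} \<times> {1..m} - outer_vertices n m"
  shows "\<exists>\<phi>. square_proper n m (outer_vertices n m \<union> T) \<phi> \<and> (\<forall>v\<in>outer_vertices n m. \<phi> v = \<phi>0 v) \<and>
    (\<forall>v\<in>T. \<phi> v \<in> A v)"
  using T
\<comment> \<open>The induction inserts an element of maximal rank; the minus sign makes it one of
  minimal coordinate sum.\<close>
proof (induction T rule: finite_ranking_induct[where f = "\<lambda>(x, y). - int (x + y)"])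
  case empty
  then show ?case using base by auto
next
  case (insert v T)
  obtain \<phi> where \<phi>: "square_proper n m (outer_vertices n m \<union> T) \<phi>"
    "\<And>w. w \<in> outer_vertices n m \<Longrightarrow> \<phi> w = \<phi>0 w" "\<And>w. w \<in> T \<Longrightarrow> \<phi> w \<in> A w"
    using insert by blast
  show ?case
  proof (cases "v \<in> T")
    case True
    then show ?thesis using \<phi> by (auto simp: insert_absorb)
  next
    case False
    obtain x y where xy: "v = (x, y)" by fastforce
    have v: "(x, y) \<in> {1..n} \<times> {1..m}" "(x, y) \<notin> outer_vertices n m" using insert.prems xy by auto
    then obtain a b where ab: "x = Suc a" "y = Suc b" "1 \<le> a" "1 \<le> b" "Suc a < n" "Suc b < m"
      by (cases x; cases y) (auto simp: outer_vertices_def)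
    let ?S = "outer_vertices n m \<union> T"
    \<comment> \<open>Both have a smaller coordinate sum than the vertex being inserted, so they can
      be coloured only as outer vertices. If both are outer, then \<open>a = b = 1\<close> and
      \<open>ne\<close> separates them.\<close>
    have T: "(a, Suc b) \<notin> T" "(Suc a, b) \<notin> T"
      using insert.hyps(2) by (force simp: xy ab)+
    have "\<phi> (a, Suc b) \<noteq> \<phi> (Suc a, b)"
      if "(a, Suc b) \<in> outer_vertices n m" "(Suc a, b) \<in> outer_vertices n m"
    proof -
      have "a = 1" "b = 1" using that ab by (auto simp: outer_vertices_def)
      then show ?thesis using that \<phi>(2) ne by (simp add: numeral_2_eq_2)
    qed
    then have sep: "(a, Suc b) \<notin> ?S \<or> (Suc a, b) \<notin> ?S \<or> \<phi> (a, Suc b) \<noteq> \<phi> (Suc a, b)"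
      using T by blast
    have notin: "(Suc a, Suc b) \<notin> ?S" using False v by (simp add: xy ab)
    from A[OF v(1)] have "finite (A v)" "5 \<le> card (A v)" by (simp_all add: xy)
    with \<phi>(1) notin obtain c where c: "c \<in> A v"
      "square_proper n m (insert (Suc a, Suc b) ?S) (\<phi>((Suc a, Suc b) := c))"
      using sep by (rule square_proper_extend)
    have "v = (Suc a, Suc b)" by (simp add: xy ab)
    then have "square_proper n m (outer_vertices n m \<union> insert v T) (\<phi>(v := c))"
      using c(2) by simp
    moreover have vo: "v \<notin> outer_vertices n m" using v(2) by (simp add: xy)
    ultimately show ?thesis
    proof (intro exI[of _ "\<phi>(v := c)"] conjI ballI)
      show "(\<phi>(v := c)) w = \<phi>0 w" if "w \<in> outer_vertices n m" for w
        using that \<phi>(2) vo by auto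
      show "(\<phi>(v := c)) w \<in> A w" if "w \<in> insert v T" for w
        using that \<phi>(3) c(1) by (cases "w = v") auto
    qed
  qed
qed

text \<open>The outer cycle has no chord: an edge joining two opposite sides of the grid would need
  a side of only two vertices.\<close>

lemma parcs_outer_vertices:
  assumes "n \<ge> 3" "m \<ge> 3" "u \<in> outer_vertices n m" "v \<in> outer_vertices n m"
    and "(u, v) \<in> parcs (grid n m)"
  shows "v = outer_next n m u \<or> u = outer_next n m v"
proof -
  obtain a b c d where uv: "u = (a, b)" "v = (c, d)" by fastforce
  consider "b = d" "c = Suc a" | "a = c" "d = Suc b" | "b = d" "a = Suc c" | "a = c" "b = Suc d"
    using assms(5) by (auto simp: uv parcs_grid)
  then show ?thesis
    by cases (use assms in \<open>auto simp: uv outer_vertices_def outer_next_def\<close>)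
qed

text \<open>For \<open>n, m \<ge> 3\<close> every unit square has an interior corner, so the
  condition on diagonals is vacuous on the outer vertices and only edges matter.\<close>

lemma square_proper_outer_vertices:
  assumes nm: "n \<ge> 3" "m \<ge> 3"
    and \<phi>: "\<And>v. v \<in> outer_vertices n m \<Longrightarrow> \<phi> (outer_next n m v) \<noteq> \<phi> v"
  shows "square_proper n m (outer_vertices n m) \<phi>"
  unfolding square_proper_def
proof (intro conjI ballI impI)
  fix u v assume "u \<in> outer_vertices n m" "v \<in> outer_vertices n m" "(u, v) \<in> parcs (grid n m)"
  then show "\<phi> u \<noteq> \<phi> v" using parcs_outer_vertices[OF nm] \<phi> by metis
next
  fix i j assume "i \<in> {1..<n}" "j \<in> {1..<m}"
    "{(i, j), (Suc i, j), (Suc i, Suc j), (i, Suc j)} \<subseteq> outer_vertices n m"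
  then show "\<not> (\<phi> (i, j) = \<phi> (Suc i, Suc j) \<and> \<phi> (Suc i, j) = \<phi> (i, Suc j))"
    using nm by (auto simp: outer_vertices_def)
qed

lemma grid_facial_nonrepetitive_5_choosable:
  assumes nm: "n \<ge> 3" "m \<ge> 3"
  shows "facial_nonrepetitive_choosable (grid n m) grid_pos 5"
  unfolding facial_nonrepetitive_choosable_def pverts_grid
proof (intro allI impI)
  let ?V = "{1..n} \<times> {1..m}" and ?N = "2 * n + 2 * m - 4" and ?o = "outer_cycle n m"
  fix L :: "nat \<times> nat \<Rightarrow> nat set"
  assume L: "\<forall>v\<in>?V. L v \<subseteq> {1..} \<and> (infinite (L v) \<or> 5 \<le> card (L v))"
  \<comment> \<open>Infinite lists are cut down to five colours, since the counting arguments need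
    finite ones.\<close>
  have "\<exists>A. A \<subseteq> L v \<and> finite A \<and> 5 \<le> card A" if "v \<in> ?V" for v
  proof (cases "finite (L v)")
    case True
    then show ?thesis using L that by blast
  next
    case False
    then obtain A where "A \<subseteq> L v" "finite A" "card A = 5"
      using infinite_arbitrarily_large by blast
    then show ?thesis by (intro exI[of _ A]) simp
  qed
  then obtain A where A: "\<And>v. v \<in> ?V \<Longrightarrow> A v \<subseteq> L v \<and> finite (A v) \<and> 5 \<le> card (A v)"
    by metis
  have outer_sub: "outer_vertices n m \<subseteq> ?V" by (auto simp: outer_vertices_def)
  note bij = bij_betw_outer_cycle[OF nm]
  have oV: "?o k \<in> outer_vertices n m" if "k < ?N" for k
    using bij_betwE[OF bij] that by simp
  have N: "?N > 0" using nm by simp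
  have "finite (A (?o k)) \<and> 5 \<le> card (A (?o k))" if "k < ?N" for k
    using A oV[OF that] outer_sub by blast
  with N obtain c where c: "\<And>k. k < ?N \<Longrightarrow> c k \<in> A (?o k)"
    and c0: "\<And>k. 0 < k \<Longrightarrow> k < ?N \<Longrightarrow> c k \<noteq> c 0"
    and nonrep: "\<And>t k. 1 \<le> k \<Longrightarrow> 2 * k \<le> ?N \<Longrightarrow> \<exists>i<k. c ((t + i) mod ?N) \<noteq> c ((t + k + i) mod ?N)"
    using cycle_nonrepetitive_5_choosable[of ?N "\<lambda>k. A (?o k)"] by blast
  define \<phi>0 where "\<phi>0 = c \<circ> inv_into {..<?N} ?o"
  have \<phi>0: "\<phi>0 (?o k) = c k" if "k < ?N" for k
    using bij that by (simp add: \<phi>0_def bij_betw_def)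
  have index: "\<exists>k<?N. v = ?o k" if "v \<in> outer_vertices n m" for v
    using bij that unfolding bij_betw_def by blast
  have "\<phi>0 (outer_next n m v) \<noteq> \<phi>0 v" if "v \<in> outer_vertices n m" for v
  proof -
    obtain k where k: "k < ?N" "v = ?o k" using index[OF \<open>v \<in> _\<close>] by blast
    \<comment> \<open>A repetition of half-length one is a monochromatic edge.\<close>
    have "c (k mod ?N) \<noteq> c (Suc k mod ?N)" using nonrep[of 1 k] nm by simp
    then show ?thesis
      using k \<phi>0[of k] \<phi>0[of "Suc k mod ?N"] outer_next_outer_cycle[OF nm k(1)] N by simp
  qed
  then have base: "square_proper n m (outer_vertices n m) \<phi>0"
    by (rule square_proper_outer_vertices[OF nm])
  \<comment> \<open>\<open>(1, 2)\<close> has index 0 on the cycle, and its colour occurs at no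
    other outer vertex.\<close>
  have "\<phi>0 (1, 2) \<noteq> \<phi>0 (2, 1)"
  proof -
    have o0: "?o 0 = (1, 2)" by (simp add: outer_cycle_def)
    have "(2, 1) \<in> outer_vertices n m" using nm by (simp add: outer_vertices_def)
    then obtain k where k: "k < ?N" "(2, 1) = ?o k" using index by blast
    then have "k \<noteq> 0" using o0 by (metis Pair_inject numeral_eq_one_iff semiring_norm(85))
    then show ?thesis using c0[of k] k \<phi>0[OF k(1)] \<phi>0[OF N] o0 by simp
  qed
  with base obtain \<phi> where \<phi>: "square_proper n m (outer_vertices n m \<union> (?V - outer_vertices n m)) \<phi>"
    "\<And>v. v \<in> outer_vertices n m \<Longrightarrow> \<phi> v = \<phi>0 v"
    "\<And>v. v \<in> ?V - outer_vertices n m \<Longrightarrow> \<phi> v \<in> A v"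
    using square_proper_interior[of n m \<phi>0 A "?V - outer_vertices n m"] A by auto
  have proper: "square_proper n m ?V \<phi>" using \<phi>(1) outer_sub by (simp add: Un_absorb1)
  have o\<phi>: "\<phi> (?o k) = c k" if "k < ?N" for k
    using \<phi>(2)[OF oV[OF that]] \<phi>0[OF that] by simp
  have "\<phi> v \<in> L v" if v: "v \<in> ?V" for v
  proof (cases "v \<in> outer_vertices n m")
    case True
    then obtain k where "k < ?N" "v = ?o k" using index by blast
    then show ?thesis using c[of k] o\<phi>[of k] A[OF v] by auto
  next
    case False
    then show ?thesis using \<phi>(3)[of v] v A[OF v] by auto
  qed
  moreover have "facial_nonrepetitive (grid n m) grid_pos \<phi>"
  proof (rule facial_nonrepetitive_gridI[OF nm proper])
    fix t k :: nat assume "1 \<le> k" "2 * k \<le> ?N"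
    then obtain i where "i < k" "c ((t + i) mod ?N) \<noteq> c ((t + k + i) mod ?N)" using nonrep by blast
    then show "\<exists>i<k. \<phi> (?o ((t + i) mod ?N)) \<noteq> \<phi> (?o ((t + k + i) mod ?N))"
      using o\<phi> N by (intro exI[of _ i]) simp
  qed
  ultimately show "\<exists>\<phi>. (\<forall>v\<in>?V. \<phi> v \<in> L v) \<and> facial_nonrepetitive (grid n m) grid_pos \<phi>" by blast
qed

theorem theorem8:
  fixes n m :: nat
  assumes "n \<ge> 3" and "m \<ge> 3"
  shows "pi_fl (cartesian_product (path_graph n) (path_graph m)) grid_pos \<le> 5"
proof -
  have "pi_fl (grid n m) grid_pos \<le> enat 5"
    unfolding pi_fl_def using grid_facial_nonrepetitive_5_choosable[OF assms]
    by (intro Inf_lower) blast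
  then show ?thesis by (simp add: numeral_eq_enat)
qed

end
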